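(* Let $0\le p_1\le p_2\le1$. There exist two nearest-neighbor random walks $S=(S_n)_{n\ge0}$ and $\tilde S=(\tilde S_n)_{n\ge0}$ on $\mathbb{Z}$, defined on the same probability space, such that (i) $S$ and $\tilde S$ are elephant random walks with parameters $p_1$ and $p_2$, respectively; (ii) for every $n\ge1$, $|S_n|\le|\tilde S_n|$. In particular, $S_n=0$ whenever $\tilde S_n=0$.
   Context: Elephant random walk (ERW) on $\mathbb{Z}$ with parameter $p\in[0,1]$: $S_0=0$, $S_1=\sigma_1=1$. For each $n\ge1$, choose $n'$ uniformly at random in $\{1,\dots,n\}$ (independently of the past); given the past and $n'$, let $\sigma_{n+1}=\sigma_{n'}$ with probability $p$ and $\sigma_{n+1}=-\sigma_{n'}$ with probability $1-p$. Set $S_{n+1}=S_n+\sigma_{n+1}$. Any process with the law of $(S_n)_{n\ge0}$ is called an ERW with parameter $p$. *)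

theory Defs
  imports "HOL-Probability.Probability"
begin

text \<open>
  The randomness driving the elephant random walk: independently for every time n \<open>\<ge>\<close> 1,
  a pair consisting of the uniform index n' in {1..n} and of a coin with success probability p
  which decides whether the step taken at time n' is repeated or reversed.
\<close>

definition erw_seed :: "real \<Rightarrow> (nat \<Rightarrow> nat \<times> bool) measure" where
  "erw_seed p =
     (\<Pi>\<^sub>M n\<in>{1..}. measure_pmf (pair_pmf (pmf_of_set {1..n}) (bernoulli_pmf p)))"

text \<open>
  The steps. The minimum is there only to make the recursion well-founded: the index drawn at
  time n almost surely lies in {1..n}. The value at index 0 is a dummy.
\<close>

fun erw_step :: "(nat \<Rightarrow> nat \<times> bool) \<Rightarrow> nat \<Rightarrow> int" where
  "erw_step \<omega> 0 = 0"
| "erw_step \<omega> (Suc 0) = 1"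
| "erw_step \<omega> (Suc (Suc m)) =
     (let n = Suc m; n' = min n (fst (\<omega> n)) in
      if snd (\<omega> n) then erw_step \<omega> n' else - erw_step \<omega> n')"

definition erw_walk :: "(nat \<Rightarrow> nat \<times> bool) \<Rightarrow> nat \<Rightarrow> int" where
  "erw_walk \<omega> n = (\<Sum>k=1..n. erw_step \<omega> k)"

abbreviation int_paths :: "(nat \<Rightarrow> int) measure" where
  "int_paths \<equiv> \<Pi>\<^sub>M n\<in>UNIV. count_space UNIV"

definition erw_law :: "real \<Rightarrow> (nat \<Rightarrow> int) measure" where
  "erw_law p = distr (erw_seed p) int_paths erw_walk"

definition elephant_random_walk :: "'a measure \<Rightarrow> real \<Rightarrow> (nat \<Rightarrow> 'a \<Rightarrow> int) \<Rightarrow> bool" where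
  "elephant_random_walk M p S \<longleftrightarrow>
     prob_space M \<and> (\<forall>n. S n \<in> measurable M (count_space UNIV)) \<and>
     distr M int_paths (\<lambda>\<omega> n. S n \<omega>) = erw_law p"

definition nearest_neighbor_walk :: "'a measure \<Rightarrow> (nat \<Rightarrow> 'a \<Rightarrow> int) \<Rightarrow> bool" where
  "nearest_neighbor_walk M S \<longleftrightarrow>
     (\<forall>n. S n \<in> measurable M (count_space UNIV)) \<and>
     (\<forall>\<omega>\<in>space M. \<forall>n. \<bar>S (Suc n) \<omega> - S n \<omega>\<bar> = 1)"

text \<open>The walk is measurable, so the image measure in the definition of the law is meaningful.\<close>

lemma measurable_erw_step: "(\<lambda>\<omega>. erw_step \<omega> k) \<in> measurable (erw_seed p) (count_space UNIV)"
proof (induction k rule: less_induct)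
  case (less k)
  consider "k = 0" | "k = Suc 0" | m where "k = Suc (Suc m)"
    by (metis not0_implies_Suc)
  then show ?case
  proof cases
    case 3
    have c: "(\<lambda>\<omega>. \<omega> (Suc m)) \<in> measurable (erw_seed p) (count_space UNIV)"
    proof -
      have "(\<lambda>\<omega>. \<omega> (Suc m)) \<in> measurable (erw_seed p)
          (measure_pmf (pair_pmf (pmf_of_set {1..Suc m}) (bernoulli_pmf p)))"
        unfolding erw_seed_def by (rule measurable_component_singleton) simp
      then show ?thesis by simp
    qed
    define f where "f = (\<lambda>(x :: nat \<times> bool) \<omega>.
      (if snd x then erw_step \<omega> (min (Suc m) (fst x)) else - erw_step \<omega> (min (Suc m) (fst x))))"
    have f: "f x \<in> measurable (erw_seed p) (count_space UNIV)" for x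
    proof -
      have s: "(\<lambda>\<omega>. erw_step \<omega> (min (Suc m) (fst x)))
          \<in> measurable (erw_seed p) (count_space UNIV)"
        by (rule less) (simp add: 3)
      have "(\<lambda>\<omega>. - erw_step \<omega> (min (Suc m) (fst x)))
          \<in> measurable (erw_seed p) (count_space UNIV)"
        by (rule measurable_compose[OF s]) simp
      with s show ?thesis unfolding f_def by (cases "snd x") simp_all
    qed
    have "(\<lambda>\<omega>. f (\<omega> (Suc m)) \<omega>) \<in> measurable (erw_seed p) (count_space UNIV)"
      by (rule measurable_compose_countable[OF f c])
    then show ?thesis by (simp add: 3 f_def Let_def)
  qed simp_all
qed

lemma measurable_erw_walk: "erw_walk \<in> measurable (erw_seed p) int_paths"
proof (rule measurable_PiM_single')
  fix n :: nat
  have "(\<lambda>\<omega>. \<Sum>k=1..m. erw_step \<omega> k) \<in> measurable (erw_seed p) (count_space UNIV)" for m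
  proof (induction m)
    case (Suc m)
    have "(\<lambda>\<omega>. (\<lambda>a b. a + b) (\<Sum>k=1..m. erw_step \<omega> k) (erw_step \<omega> (Suc m)))
        \<in> measurable (erw_seed p) (count_space UNIV)"
      by (rule measurable_compose_countable[OF
            measurable_compose[OF measurable_erw_step] Suc]) simp
    then show ?case by simp
  qed simp
  then show "(\<lambda>\<omega>. erw_walk \<omega> n) \<in> measurable (erw_seed p) (count_space UNIV)"
    unfolding erw_walk_def .
qed simp

end

theory Submission
  imports Defs
begin

text \<open>
  Given the past, an elephant random walk at position \<open>s\<close> at time \<open>n \<ge> 1\<close> has
  \<open>(n + s)/2\<close> up-steps and \<open>(n - s)/2\<close> down-steps to choose from, so its next step is \<open>d = \<plusminus>1\<close>
  with probability \<open>1/2 + (2 p - 1) d s / (2 n)\<close>. The memory has disappeared: the walk is a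
  time-inhomogeneous Markov chain on the integers. Its distance to the origin moves outwards from
  \<open>\<bar>s\<bar> > 0\<close> with probability \<open>1/2 + (2 p - 1) \<bar>s\<bar> / (2 n)\<close>, which increases with \<open>p\<close>, and always
  moves outwards from \<open>0\<close>.

  The coupling drives the chains for both parameters by the same sequence of independent uniform
  variables \<open>u n\<close>: each walk moves outwards at time \<open>n\<close> exactly if \<open>u n\<close> lies below its outward
  probability, where at \<open>0\<close> the upward direction counts as outward and the threshold is \<open>1/2\<close>
  (\<open>outward_walk\<close>). The inequality between the distances is then preserved for every \<open>u\<close>
  (\<open>abs_outward_walk_mono\<close>). If the distances agree, the thresholds are ordered as the parameters
  are. If they differ, they differ by at least \<open>2\<close>, because both positions have the parity of \<open>n\<close>,
  and one step cannot reverse their order.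

  That both constructions have the same law is checked on initial segments of paths: the
  transition probabilities determine the probability of every initial segment
  (\<open>erw_markov_measure_path_event\<close>), and these determine the law (\<open>path_law_eqI\<close>). The transition
  probabilities of both constructions come from \<open>measure_path_event_Suc\<close>, which uses that the
  randomness consumed at time \<open>n\<close> is independent of the path up to time \<open>n\<close>.
\<close>

section \<open>Initial segments determine the law of an integer path\<close>

definition path_event :: "'a measure \<Rightarrow> (nat \<Rightarrow> 'a \<Rightarrow> int) \<Rightarrow> nat \<Rightarrow> (nat \<Rightarrow> int) \<Rightarrow> 'a set" where
  "path_event M X n y = {\<omega> \<in> space M. \<forall>k\<le>n. X k \<omega> = y k}"

definition path_prefix :: "(nat \<Rightarrow> 'a \<Rightarrow> int) \<Rightarrow> nat \<Rightarrow> 'a \<Rightarrow> int list" where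
  "path_prefix X n \<omega> = map (\<lambda>k. X k \<omega>) [0..<Suc n]"

lemma path_event_Suc:
  "path_event M X (Suc n) y = {\<omega> \<in> path_event M X n y. X (Suc n) \<omega> = y (Suc n)}"
  unfolding path_event_def by (auto simp: le_Suc_eq)

lemma sets_path_event:
  assumes [measurable]: "\<And>k. X k \<in> measurable M (count_space UNIV)"
  shows "path_event M X n y \<in> sets M"
  unfolding path_event_def by measurable

lemma path_prefix_vimage:
  "path_prefix X n -` {l} \<inter> space M = (if length l = Suc n then path_event M X n ((!) l) else {})"
proof -
  have "path_prefix X n \<omega> = l \<longleftrightarrow> length l = Suc n \<and> (\<forall>k\<le>n. X k \<omega> = l ! k)" for \<omega>
    unfolding path_prefix_def list_eq_iff_nth_eq
    by (metis length_map length_upt diff_zero nth_map_upt add_0 less_Suc_eq_le)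
  then show ?thesis by (auto simp: path_event_def)
qed

lemma measurable_path_prefix:
  assumes "\<And>k. X k \<in> measurable M (count_space UNIV)"
  shows "path_prefix X n \<in> measurable M (count_space UNIV)"
  by (subst measurable_count_space_eq2_countable)
     (auto simp: path_prefix_vimage intro: sets_path_event assms)

text \<open>
  The initial segments are countable in number, so their probabilities determine the law of the list
  of the first \<open>n + 1\<close> positions; every finite-dimensional rectangle is a condition on such a list.
\<close>

lemma path_law_eqI:
  assumes M: "prob_space M" and N: "prob_space N"
    and X: "\<And>n. X n \<in> measurable M (count_space UNIV)"
    and Y: "\<And>n. Y n \<in> measurable N (count_space UNIV)"
    and eq: "\<And>n y. measure M (path_event M X n y) = measure N (path_event N Y n y)"
  shows "distr M int_paths (\<lambda>\<omega> n. X n \<omega>) = distr N int_paths (\<lambda>\<omega> n. Y n \<omega>)"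
proof -
  interpret M: prob_space M by fact
  interpret N: prob_space N by fact
  have mX: "(\<lambda>\<omega> n. X n \<omega>) \<in> measurable M int_paths"
    by (rule measurable_PiM_single') (use X in auto)
  have mY: "(\<lambda>\<omega> n. Y n \<omega>) \<in> measurable N int_paths"
    by (rule measurable_PiM_single') (use Y in auto)
  note pX = measurable_path_prefix[of X, OF X] and pY = measurable_path_prefix[of Y, OF Y]
  have prefix_law: "distr M (count_space UNIV) (path_prefix X n) = distr N (count_space UNIV) (path_prefix Y n)" for n
    by (rule measure_eqI_countable[of _ UNIV])
       (auto simp: emeasure_distr[OF pX] emeasure_distr[OF pY] path_prefix_vimage
          M.emeasure_eq_measure N.emeasure_eq_measure eq)
  show ?thesis
  proof (rule measure_eqI_PiM_infinite)
    show "finite_measure (distr M int_paths (\<lambda>\<omega> n. X n \<omega>))"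
      using M.prob_space_distr[OF mX] by (simp add: prob_space_def)
    fix A :: "nat \<Rightarrow> int set" and J :: "nat set"
    assume J: "finite J" "J \<subseteq> UNIV" and A: "\<And>i. i \<in> J \<Longrightarrow> A i \<in> sets (count_space UNIV)"
    define n where "n = Max (insert 0 J)"
    have n: "j \<le> n" if "j \<in> J" for j using that J by (simp add: n_def)
    define L where "L = {l :: int list. \<forall>j\<in>J. l ! j \<in> A j}"
    let ?R = "prod_emb UNIV (\<lambda>_. count_space UNIV) J (Pi\<^sub>E J A)"
    have R: "?R \<in> sets int_paths"
      using J A by (intro sets_PiM_I) auto
    have iff: "x \<in> ?R \<longleftrightarrow> map x [0..<Suc n] \<in> L" for x :: "nat \<Rightarrow> int"
      using n by (auto simp: prod_emb_def L_def PiE_iff less_Suc_eq_le simp del: upt_Suc)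
    have "emeasure (distr M int_paths (\<lambda>\<omega> n. X n \<omega>)) ?R
        = emeasure (distr M (count_space UNIV) (path_prefix X n)) L"
      unfolding emeasure_distr[OF mX R] by (subst emeasure_distr[OF pX]) (auto simp: iff path_prefix_def vimage_def)
    also have "\<dots> = emeasure (distr N (count_space UNIV) (path_prefix Y n)) L"
      by (simp add: prefix_law)
    also have "\<dots> = emeasure (distr N int_paths (\<lambda>\<omega> n. Y n \<omega>)) ?R"
      unfolding emeasure_distr[OF mY R] by (subst emeasure_distr[OF pY]) (auto simp: iff path_prefix_def vimage_def)
    finally show "emeasure (distr M int_paths (\<lambda>\<omega> n. X n \<omega>)) ?R
        = emeasure (distr N int_paths (\<lambda>\<omega> n. Y n \<omega>)) ?R" .
  qed simp_all
qed

section \<open>Walks driven by independent variables\<close>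

text \<open>
  Resampling the coordinate \<open>j\<close> independently does not change the product measure, and it turns the
  event on the left into a rectangle.
\<close>

lemma measure_PiM_Int_component:
  assumes N: "\<And>i. i \<in> I \<Longrightarrow> prob_space (N i)" and j: "j \<in> I"
    and A: "A \<in> sets (PiM I N)" and B: "B \<in> sets (N j)"
    and indep: "\<And>f x. f \<in> space (PiM I N) \<Longrightarrow> x \<in> space (N j) \<Longrightarrow> f(j := x) \<in> A \<longleftrightarrow> f \<in> A"
  shows "measure (PiM I N) {f \<in> A. f j \<in> B} = measure (PiM I N) A * measure (N j) B"
proof -
  let ?P = "PiM I N"
  interpret P: prob_space ?P by (rule prob_space_PiM) (rule N)
  interpret Nj: prob_space "N j" by (rule N) (rule j)
  have upd [measurable]: "(\<lambda>(x, f). f(j := x)) \<in> measurable (N j \<Otimes>\<^sub>M ?P) ?P"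
    using j measurable_fun_upd[of I I j snd "N j \<Otimes>\<^sub>M ?P" N fst] by (auto simp: insert_absorb split_beta')
  have law: "distr (N j \<Otimes>\<^sub>M ?P) ?P (\<lambda>(x, f). f(j := x)) = ?P"
    using distr_pair_PiM_eq_PiM[of I N j] N j by (simp add: insert_absorb)
  have E: "{f \<in> A. f j \<in> B} \<in> sets ?P"
  proof -
    have "{f \<in> A. f j \<in> B} = A \<inter> ((\<lambda>f. f j) -` B \<inter> space ?P)"
      using sets.sets_into_space[OF A] by auto
    then show ?thesis
      using A measurable_sets[OF measurable_component_singleton[OF j, of N], of B] B by auto
  qed
  have pre: "(\<lambda>(x, f). f(j := x)) -` {f \<in> A. f j \<in> B} \<inter> space (N j \<Otimes>\<^sub>M ?P) = B \<times> A"
    using sets.sets_into_space[OF A] sets.sets_into_space[OF B] indep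
    by (auto simp: space_pair_measure)
  have "emeasure ?P {f \<in> A. f j \<in> B} = emeasure (N j \<Otimes>\<^sub>M ?P) (B \<times> A)"
    by (subst law[symmetric], subst emeasure_distr[OF upd E]) (simp only: pre)
  also have "\<dots> = emeasure (N j) B * emeasure ?P A"
    by (rule P.emeasure_pair_measure_Times[OF B A])
  finally show ?thesis
    by (simp add: P.emeasure_eq_measure Nj.emeasure_eq_measure ennreal_mult'[symmetric] mult.commute)
qed

text \<open>
  One transition of a process whose path up to time \<open>n\<close> does not look at the coordinate \<open>n\<close>. The set
  \<open>B\<close> of values that produce the prescribed next position may depend on the prescribed path, and only
  needs to be found when that path has positive probability: this leaves out paths that arise only
  from exceptional values of the driving variables.
\<close>

lemma measure_path_event_Suc:
  assumes N: "\<And>i. i \<in> I \<Longrightarrow> prob_space (N i)" and n: "n \<in> I"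
    and X: "\<And>k. X k \<in> measurable (PiM I N) (count_space UNIV)"
    and adapted: "\<And>k f x. k \<le> n \<Longrightarrow> X k (f(n := x)) = X k f"
    and step: "measure (PiM I N) (path_event (PiM I N) X n y) \<noteq> 0 \<Longrightarrow>
      \<exists>B\<in>sets (N n). measure (N n) B = q \<and>
        (\<forall>\<omega>\<in>path_event (PiM I N) X n y. X (Suc n) \<omega> = y (Suc n) \<longleftrightarrow> \<omega> n \<in> B)"
  shows "measure (PiM I N) (path_event (PiM I N) X (Suc n) y)
    = measure (PiM I N) (path_event (PiM I N) X n y) * q"
proof (cases "measure (PiM I N) (path_event (PiM I N) X n y) = 0")
  case True
  interpret prob_space "PiM I N" by (rule prob_space_PiM) (rule N)
  have "measure (PiM I N) (path_event (PiM I N) X (Suc n) y)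
      \<le> measure (PiM I N) (path_event (PiM I N) X n y)"
    by (rule finite_measure_mono) (auto simp: path_event_Suc intro!: sets_path_event X)
  then show ?thesis using True by (simp add: measure_le_0_iff)
next
  case False
  let ?E = "path_event (PiM I N) X n y"
  from step[OF False] obtain B where B: "B \<in> sets (N n)" "measure (N n) B = q"
    and iff: "\<And>\<omega>. \<omega> \<in> ?E \<Longrightarrow> X (Suc n) \<omega> = y (Suc n) \<longleftrightarrow> \<omega> n \<in> B"
    by blast
  have "path_event (PiM I N) X (Suc n) y = {\<omega> \<in> ?E. \<omega> n \<in> B}"
    using iff by (auto simp: path_event_Suc)
  also have "measure (PiM I N) \<dots> = measure (PiM I N) ?E * q"
    unfolding B(2)[symmetric]
  proof (rule measure_PiM_Int_component[OF N n sets_path_event[OF X] B(1)])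
    fix f x assume *: "f \<in> space (PiM I N)" "x \<in> space (N n)"
    then have "f(n := x) \<in> space (PiM I N)"
      using n by (auto simp: space_PiM PiE_iff extensional_def)
    with * show "f(n := x) \<in> ?E \<longleftrightarrow> f \<in> ?E"
      by (simp add: path_event_def adapted)
  qed
  finally show ?thesis .
qed

section \<open>The elephant random walk as a Markov chain\<close>

definition erw_transition :: "real \<Rightarrow> nat \<Rightarrow> int \<Rightarrow> int \<Rightarrow> real" where
  "erw_transition p n s d =
    (if \<bar>d\<bar> = 1 then 1/2 + (2 * p - 1) * (of_int d * of_int s) / (2 * real n) else 0)"

text \<open>
  The Markov property in product form, which avoids conditioning on events of probability zero. The
  first step is deterministic and is listed separately, since the transition formula divides by \<open>n\<close>.
\<close>

definition erw_markov :: "'a measure \<Rightarrow> real \<Rightarrow> (nat \<Rightarrow> 'a \<Rightarrow> int) \<Rightarrow> bool" where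
  "erw_markov M p X \<longleftrightarrow>
    (\<forall>\<omega>\<in>space M. X 0 \<omega> = 0 \<and> X 1 \<omega> = 1) \<and>
    (\<forall>n\<ge>1. \<forall>y. measure M (path_event M X (Suc n) y)
        = measure M (path_event M X n y) * erw_transition p n (y n) (y (Suc n) - y n))"

lemma erw_markov_measure_path_event:
  assumes "prob_space M" and "prob_space N" and "erw_markov M p X" and "erw_markov N p Y"
  shows "measure M (path_event M X n y) = measure N (path_event N Y n y)"
proof (induction n)
  case 0
  have "path_event M X 0 y = (if y 0 = 0 then space M else {})"
       "path_event N Y 0 y = (if y 0 = 0 then space N else {})"
    using assms(3,4) by (auto simp: path_event_def erw_markov_def)
  then show ?case using assms(1,2) by (simp add: prob_space.prob_space)
next
  case (Suc n)
  show ?case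
  proof (cases "n = 0")
    case True
    have "path_event M X (Suc 0) y = (if y 0 = 0 \<and> y 1 = 1 then space M else {})"
         "path_event N Y (Suc 0) y = (if y 0 = 0 \<and> y 1 = 1 then space N else {})"
      using assms(3,4) by (auto simp: path_event_def erw_markov_def le_Suc_eq)
    then show ?thesis using assms(1,2) True by (simp add: prob_space.prob_space)
  next
    case False
    with assms(3,4) Suc show ?thesis by (simp add: erw_markov_def)
  qed
qed

lemma erw_markov_path_law_unique:
  assumes "prob_space M" and "prob_space N" and "erw_markov M p X" and "erw_markov N p Y"
    and "\<And>n. X n \<in> measurable M (count_space UNIV)" and "\<And>n. Y n \<in> measurable N (count_space UNIV)"
  shows "distr M int_paths (\<lambda>\<omega> n. X n \<omega>) = distr N int_paths (\<lambda>\<omega> n. Y n \<omega>)"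
  using assms by (intro path_law_eqI erw_markov_measure_path_event)

lemma erw_step_cong:
  "(\<And>i. i < k \<Longrightarrow> \<omega> i = \<omega>' i) \<Longrightarrow> erw_step \<omega> k = erw_step \<omega>' k"
proof (induction k rule: less_induct)
  case (less k)
  consider "k = 0" | "k = Suc 0" | m where "k = Suc (Suc m)"
    by (metis not0_implies_Suc)
  then show ?case
  proof cases
    case (3 m)
    have "erw_step \<omega> i = erw_step \<omega>' i" if "i \<le> Suc m" for i
      using that 3 by (intro less.IH) (auto intro: less.prems)
    then show ?thesis using less.prems[of "Suc m"] 3 by (simp add: Let_def)
  qed simp_all
qed

text \<open>
  An index \<open>0\<close> would select the dummy step, which is neither \<open>1\<close> nor \<open>-1\<close>.
\<close>

lemma abs_erw_step:
  assumes "\<And>i. i \<ge> 1 \<Longrightarrow> fst (\<omega> i) \<ge> 1"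
  shows "k \<ge> 1 \<Longrightarrow> \<bar>erw_step \<omega> k\<bar> = 1"
proof (induction k rule: less_induct)
  case (less k)
  then consider "k = Suc 0" | m where "k = Suc (Suc m)"
    by (metis not0_implies_Suc not_one_le_zero)
  then show ?case
  proof cases
    case (2 m)
    have "\<bar>erw_step \<omega> (min (Suc m) (fst (\<omega> (Suc m))))\<bar> = 1"
      using 2 assms[of "Suc m"] by (intro less.IH) auto
    then show ?thesis using 2 by (simp add: Let_def)
  qed simp
qed

lemma card_sign_eq:
  fixes e :: "'a \<Rightarrow> int"
  assumes "finite A" and "\<And>i. i \<in> A \<Longrightarrow> \<bar>e i\<bar> = 1" and "\<bar>d\<bar> = 1"
  shows "real (card {i\<in>A. e i = d}) = (real (card A) + of_int d * of_int (\<Sum>i\<in>A. e i)) / 2"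
proof -
  have "d * (\<Sum>i\<in>A. e i) = (\<Sum>i\<in>A. 2 * of_bool (e i = d) - 1)"
    unfolding sum_distrib_left
  proof (rule sum.cong[OF refl])
    fix i assume "i \<in> A"
    then have "\<bar>e i\<bar> = 1" by (rule assms)
    with assms(3) show "d * e i = 2 * of_bool (e i = d) - 1"
      by (auto simp: abs_if split: if_splits)
  qed
  also have "\<dots> = 2 * int (card {i\<in>A. e i = d}) - int (card A)"
    using assms(1) by (simp add: sum_subtractf sum_distrib_left[symmetric] Int_def)
  finally have "real_of_int (d * (\<Sum>i\<in>A. e i)) = real_of_int (2 * int (card {i\<in>A. e i = d}) - int (card A))"
    by (simp only:)
  then show ?thesis by simp
qed

text \<open>
  The step \<open>d\<close> arises by repeating one of the earlier steps \<open>d\<close> or by reversing one of the earlier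
  steps \<open>-d\<close>, and the sum of the steps tells how many there are of each kind.
\<close>

lemma measure_erw_choice:
  fixes e :: "nat \<Rightarrow> int"
  assumes n: "n \<ge> 1" and p: "0 \<le> p" "p \<le> 1" and e: "\<And>i. i \<in> {1..n} \<Longrightarrow> \<bar>e i\<bar> = 1"
  shows "measure_pmf.prob (pair_pmf (pmf_of_set {1..n}) (bernoulli_pmf p))
      {x. (if snd x then e (min n (fst x)) else - e (min n (fst x))) = d}
    = erw_transition p n (\<Sum>i=1..n. e i) d" (is "measure_pmf.prob ?P ?B = _")
proof -
  define C where "C d = {i\<in>{1..n}. e i = d}" for d
  have "set_pmf ?P \<subseteq> {1..n} \<times> UNIV" using n by auto
  then have "measure_pmf.prob ?P ?B = measure_pmf.prob ?P (C d \<times> {True} \<union> C (-d) \<times> {False})"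
    by (intro measure_pmf.finite_measure_eq_AE) (auto simp: AE_measure_pmf_iff C_def split: if_splits)
  also have "\<dots> = measure_pmf.prob ?P (C d \<times> {True}) + measure_pmf.prob ?P (C (-d) \<times> {False})"
    by (rule measure_pmf.finite_measure_Union) auto
  also have "\<dots> = real (card (C d)) / real n * p + real (card (C (-d))) / real n * (1 - p)"
  proof -
    have "{1..n} \<inter> C c = C c" for c by (auto simp: C_def)
    then show ?thesis
      using n p by (subst (1 2) measure_pmf_prob_product) (simp_all add: measure_pmf_of_set measure_pmf_single)
  qed
  also have "\<dots> = erw_transition p n (\<Sum>i=1..n. e i) d"
  proof (cases "\<bar>d\<bar> = 1")
    case True
    define D where "D = real_of_int d * of_int (\<Sum>i=1..n. e i)"
    have card: "real (card (C d)) = (real n + D) / 2" "real (card (C (-d))) = (real n - D) / 2"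
      unfolding C_def D_def using card_sign_eq[of "{1..n}" e d] card_sign_eq[of "{1..n}" e "-d"] e True
      by simp_all
    have "(real n + D) / 2 / real n * p + (real n - D) / 2 / real n * (1 - p)
        = 1/2 + (2 * p - 1) * D / (2 * real n)"
      using n by (simp add: field_simps)
    then show ?thesis
      using True by (simp only: card erw_transition_def D_def[symmetric] if_True refl)
  next
    case False
    have "e i \<noteq> d" "e i \<noteq> - d" if "i \<in> {1..n}" for i
      using e[OF that] False by auto
    then have "C d = {}" "C (-d) = {}" by (auto simp: C_def)
    then show ?thesis using False by (simp add: erw_transition_def)
  qed
  finally show ?thesis .
qed

lemma prob_space_erw_seed: "prob_space (erw_seed p)"
  unfolding erw_seed_def by (rule prob_space_PiM) (rule prob_space_measure_pmf)

lemma AE_erw_seed_index: "AE \<omega> in erw_seed p. \<forall>i\<ge>1. fst (\<omega> i) \<ge> 1"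
  unfolding AE_all_countable
proof
  fix i :: nat
  have "AE \<omega> in erw_seed p. fst (\<omega> i) \<ge> 1" if "i \<ge> 1"
    unfolding erw_seed_def
    by (rule AE_PiM_component[where P = "\<lambda>x. fst x \<ge> 1" and i = i])
       (use that in \<open>auto simp: AE_measure_pmf_iff prob_space_measure_pmf\<close>)
  then show "AE \<omega> in erw_seed p. i \<ge> 1 \<longrightarrow> fst (\<omega> i) \<ge> 1"
    by (cases "i \<ge> 1") auto
qed

text \<open>
  On a path of positive probability there is a point of the probability space at which all drawn
  indices are valid. Its steps are \<open>1\<close> or \<open>-1\<close>, and they are the steps of every other point with the
  same path, so that the next step depends only on the variable drawn at time \<open>n\<close>.
\<close>

lemma erw_markov_erw_walk:
  assumes p: "0 \<le> p" "p \<le> 1"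
  shows "erw_markov (erw_seed p) p (\<lambda>n \<omega>. erw_walk \<omega> n)"
  unfolding erw_markov_def
proof (intro conjI ballI allI impI)
  fix n y assume n: "(1::nat) \<le> n"
  let ?X = "\<lambda>n \<omega>. erw_walk \<omega> n"
  let ?N = "\<lambda>n. measure_pmf (pair_pmf (pmf_of_set {1..n}) (bernoulli_pmf p))"
  have X: "?X k \<in> measurable (erw_seed p) (count_space UNIV)" for k
    using measurable_compose[OF measurable_erw_walk measurable_component_singleton, of k] by simp
  show "measure (erw_seed p) (path_event (erw_seed p) ?X (Suc n) y)
      = measure (erw_seed p) (path_event (erw_seed p) ?X n y) * erw_transition p n (y n) (y (Suc n) - y n)"
    unfolding erw_seed_def
  proof (rule measure_path_event_Suc, unfold erw_seed_def[symmetric])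
    fix k f x assume "k \<le> n"
    then show "erw_walk (f(n := x)) k = erw_walk f k"
      unfolding erw_walk_def by (intro sum.cong refl erw_step_cong) auto
  next
    assume pos: "measure (erw_seed p) (path_event (erw_seed p) ?X n y) \<noteq> 0"
    \<comment> \<open>A point of the event at which no dummy step is selected fixes the signs of the past steps.\<close>
    have "\<exists>\<omega>\<in>path_event (erw_seed p) ?X n y. \<forall>i\<ge>1. fst (\<omega> i) \<ge> 1"
    proof (rule ccontr)
      assume none: "\<not> ?thesis"
      have "AE \<omega> in erw_seed p. \<omega> \<notin> path_event (erw_seed p) ?X n y"
        using AE_erw_seed_index[of p] by eventually_elim (use none in auto)
      then have "measure (erw_seed p) (path_event (erw_seed p) ?X n y) = 0"
        using AE_iff_null_sets[OF sets_path_event[of ?X, OF X]] by (simp add: measure_eq_0_null_sets)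
      with pos show False by simp
    qed
    then obtain \<omega>0 where \<omega>0: "\<omega>0 \<in> path_event (erw_seed p) ?X n y" "\<And>i. i \<ge> 1 \<Longrightarrow> fst (\<omega>0 i) \<ge> 1"
      by blast
    define e where "e = erw_step \<omega>0"
    have diff: "erw_step \<omega> k = erw_walk \<omega> k - erw_walk \<omega> (k - 1)" if "k \<ge> 1" for \<omega> k
      using that by (cases k) (simp_all add: erw_walk_def)
    have steps: "erw_step \<omega> k = e k" if "\<omega> \<in> path_event (erw_seed p) ?X n y" "1 \<le> k" "k \<le> n" for \<omega> k
      unfolding e_def using that \<omega>0(1) by (simp add: diff path_event_def)
    let ?B = "{x. (if snd x then e (min n (fst x)) else - e (min n (fst x))) = y (Suc n) - y n}"
    have "y n = (\<Sum>i=1..n. e i)"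
      using \<omega>0(1) by (simp add: path_event_def erw_walk_def e_def)
    moreover have "\<bar>e i\<bar> = 1" if "i \<in> {1..n}" for i
      unfolding e_def by (rule abs_erw_step) (use \<omega>0(2) that in auto)
    ultimately have "measure (?N n) ?B = erw_transition p n (y n) (y (Suc n) - y n)"
      by (simp only: measure_erw_choice[OF n p])
    moreover have "erw_walk \<omega> (Suc n) = y (Suc n) \<longleftrightarrow> \<omega> n \<in> ?B"
      if \<omega>: "\<omega> \<in> path_event (erw_seed p) ?X n y" for \<omega>
    proof -
      have zero: "erw_step \<omega> 0 = e 0" by (simp add: e_def)
      have same: "erw_step \<omega> (min n i) = e (min n i)" for i
        using steps[OF \<omega>, of "min n i"] zero n by (cases i) auto
      have "erw_step \<omega> (Suc n) = (if snd (\<omega> n) then e (min n (fst (\<omega> n))) else - e (min n (fst (\<omega> n))))"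
        using n same by (cases n) (simp_all add: Let_def)
      moreover have "erw_walk \<omega> (Suc n) = y n + erw_step \<omega> (Suc n)"
        using \<omega> by (simp add: path_event_def erw_walk_def)
      ultimately show ?thesis by auto
    qed
    ultimately show "\<exists>B\<in>sets (?N n). measure (?N n) B = erw_transition p n (y n) (y (Suc n) - y n) \<and>
        (\<forall>\<omega>\<in>path_event (erw_seed p) ?X n y. ?X (Suc n) \<omega> = y (Suc n) \<longleftrightarrow> \<omega> n \<in> B)"
      by (intro bexI[of _ ?B]) auto
  qed (use n X prob_space_measure_pmf in auto)
qed (simp_all add: erw_walk_def)

section \<open>The walk driven by uniform variables and the coupling\<close>

text \<open>
  At the origin the threshold is \<open>1/2\<close>, so the arbitrary choice of the upward direction as outward
  makes both directions equally likely there, as required by symmetry.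
\<close>

fun outward_walk :: "real \<Rightarrow> (nat \<Rightarrow> real) \<Rightarrow> nat \<Rightarrow> int" where
  "outward_walk p u 0 = 0"
| "outward_walk p u (Suc n) =
    (let s = outward_walk p u n; e = (if 0 \<le> s then 1 else -1) in
     if n = 0 \<or> u n < 1/2 + (2 * p - 1) * \<bar>of_int s\<bar> / (2 * real n) then s + e else s - e)"

lemma abs_outward_walk_step: "\<bar>outward_walk p u (Suc n) - outward_walk p u n\<bar> = 1"
  by (simp add: Let_def)

lemma abs_outward_walk_le: "\<bar>outward_walk p u n\<bar> \<le> int n"
proof (induction n)
  case (Suc n)
  then show ?case using abs_outward_walk_step[of p u n] by linarith
qed simp

lemma even_outward_walk_add: "even (outward_walk p u n + int n)"
  by (induction n) (auto simp: Let_def)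

lemma abs_outward_walk_Suc:
  "\<bar>outward_walk p u (Suc n)\<bar> =
    (if n = 0 \<or> outward_walk p u n = 0
        \<or> u n < 1/2 + (2 * p - 1) * of_int \<bar>outward_walk p u n\<bar> / (2 * real n)
     then \<bar>outward_walk p u n\<bar> + 1 else \<bar>outward_walk p u n\<bar> - 1)"
  by (auto simp: Let_def)

text \<open>
  Where the distances agree, the thresholds are ordered as the parameters are. Where they differ, parity
  leaves a gap of at least \<open>2\<close>, which a single step of each walk can close but not reverse.
\<close>

lemma abs_outward_walk_mono:
  assumes "p \<le> p'"
  shows "\<bar>outward_walk p u n\<bar> \<le> \<bar>outward_walk p' u n\<bar>"
proof (induction n)
  case (Suc n)
  let ?s = "outward_walk p u n" and ?t = "outward_walk p' u n"
  show ?case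
  proof (cases "\<bar>?s\<bar> = \<bar>?t\<bar>")
    case True
    have "(2 * p - 1) * of_int \<bar>?t\<bar> / (2 * real n) \<le> (2 * p' - 1) * of_int \<bar>?t\<bar> / (2 * real n)"
      using assms by (intro divide_right_mono mult_right_mono) auto
    then show ?thesis
      using True unfolding abs_outward_walk_Suc by auto
  next
    case False
    have "even (\<bar>?t\<bar> - \<bar>?s\<bar>)"
      using even_outward_walk_add[of p u n] even_outward_walk_add[of p' u n] by auto
    with False Suc.IH have "\<bar>?s\<bar> + 2 \<le> \<bar>?t\<bar>" by presburger
    then show ?thesis
      using abs_outward_walk_step[of p u n] abs_outward_walk_step[of p' u n] by linarith
  qed
qed simp

lemma outward_walk_cong:
  "(\<And>i. i < k \<Longrightarrow> u i = v i) \<Longrightarrow> outward_walk p u k = outward_walk p v k"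
  by (induction k) (simp_all add: Let_def)

section \<open>The law of the coupled walks\<close>

abbreviation unif01 :: "real measure" where
  "unif01 \<equiv> uniform_measure lborel {0..1}"

definition uniform_seed :: "(nat \<Rightarrow> real) measure" where
  "uniform_seed = (\<Pi>\<^sub>M n\<in>UNIV. unif01)"

lemma prob_space_unif01: "prob_space unif01"
  by (rule prob_space_uniform_measure) auto

lemma prob_space_uniform_seed: "prob_space uniform_seed"
  unfolding uniform_seed_def by (rule prob_space_PiM) (rule prob_space_unif01)

lemma measure_unif01_lessThan:
  assumes "0 \<le> t" "t \<le> 1"
  shows "measure unif01 {..<t} = t"
proof -
  have "{0..1} \<inter> {..<t} = {0..<t}" using assms by auto
  then show ?thesis using assms by simp
qed

lemma measure_unif01_atLeast:
  assumes "0 \<le> t" "t \<le> 1"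
  shows "measure unif01 {t..} = 1 - t"
proof -
  have "{0..1} \<inter> {t..} = {t..1}" using assms by auto
  then show ?thesis using assms by simp
qed

lemma measurable_outward_walk:
  "(\<lambda>u. outward_walk p u k) \<in> measurable uniform_seed (count_space UNIV)"
proof (induction k)
  case (Suc n)
  have [measurable]: "(\<lambda>u. u n) \<in> measurable uniform_seed borel"
    using measurable_component_singleton[of n UNIV "\<lambda>_. unif01"]
    by (simp add: uniform_seed_def)
  define f where "f s u = (let e = (if 0 \<le> s then 1 else -1) in
     if n = 0 \<or> u n < 1/2 + (2 * p - 1) * \<bar>of_int s\<bar> / (2 * real n) then s + e else s - e)"
    for s :: int and u :: "nat \<Rightarrow> real"
  have "(\<lambda>u. f (outward_walk p u n) u) \<in> measurable uniform_seed (count_space UNIV)"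
    by (rule measurable_compose_countable[OF _ Suc]) (simp add: f_def Let_def)
  then show ?case by (simp add: f_def Let_def)
qed simp

text \<open>
  The bound \<open>\<bar>y n\<bar> \<le> n\<close>, valid on every path that occurs, puts the threshold into the unit interval, so
  that it is the probability of an outward step. On the negative side an outward step is a down-step;
  the transition formula is invariant under changing the signs of both position and step.
\<close>

lemma erw_markov_outward_walk:
  assumes p: "0 \<le> p" "p \<le> 1"
  shows "erw_markov uniform_seed p (\<lambda>n u. outward_walk p u n)"
  unfolding erw_markov_def
proof (intro conjI ballI allI impI)
  fix n y assume n: "(1::nat) \<le> n"
  let ?X = "\<lambda>n u. outward_walk p u n"
  show "measure uniform_seed (path_event uniform_seed ?X (Suc n) y)
      = measure uniform_seed (path_event uniform_seed ?X n y) * erw_transition p n (y n) (y (Suc n) - y n)"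
    unfolding uniform_seed_def
  proof (rule measure_path_event_Suc, unfold uniform_seed_def[symmetric])
    fix k f x assume "k \<le> n"
    then show "outward_walk p (f(n := x)) k = outward_walk p f k"
      by (intro outward_walk_cong) auto
  next
    assume "measure uniform_seed (path_event uniform_seed ?X n y) \<noteq> 0"
    then have "path_event uniform_seed ?X n y \<noteq> {}" by auto
    then obtain u0 where "outward_walk p u0 n = y n"
      by (auto simp: path_event_def)
    then have yn: "\<bar>real_of_int (y n)\<bar> \<le> real n"
      using abs_outward_walk_le[of p u0 n] by linarith
    define e :: int where "e = (if 0 \<le> y n then 1 else -1)"
    define t where "t = 1/2 + (2 * p - 1) * \<bar>real_of_int (y n)\<bar> / (2 * real n)"
    have "\<bar>(2 * p - 1) * \<bar>real_of_int (y n)\<bar>\<bar> \<le> 1 * real n"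
      unfolding abs_mult using p yn by (intro mult_mono) auto
    then have "\<bar>(2 * p - 1) * \<bar>real_of_int (y n)\<bar> / (2 * real n)\<bar> \<le> 1/2"
      using n by (simp add: divide_le_eq)
    then have t: "0 \<le> t" "t \<le> 1"
      unfolding t_def abs_le_iff by linarith+
    define d where "d = y (Suc n) - y n"
    define B where "B = (if d = e then {..<t} else if d = -e then {t..} else {})"
    have e: "\<bar>e\<bar> = 1" "of_int e * real_of_int (y n) = \<bar>real_of_int (y n)\<bar>"
      by (simp_all add: e_def)
    have "measure unif01 B = erw_transition p n (y n) d"
    proof -
      consider "d = e" | "d = -e" | "\<bar>d\<bar> \<noteq> 1" using e by linarith
      then show ?thesis
      proof cases
        case 1
        then show ?thesis
          using e measure_unif01_lessThan[OF t] by (simp add: B_def erw_transition_def t_def)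
      next
        case 2
        have "measure unif01 B = 1 - t" using 2 e measure_unif01_atLeast[OF t] by (simp add: B_def)
        also have "\<dots> = erw_transition p n (y n) d" using 2 e by (simp add: erw_transition_def t_def)
        finally show ?thesis .
      next
        case 3
        then have "B = {}" using e by (auto simp: B_def)
        then show ?thesis using 3 by (simp add: erw_transition_def)
      qed
    qed
    moreover have "outward_walk p u (Suc n) = y (Suc n) \<longleftrightarrow> u n \<in> B"
      if "u \<in> path_event uniform_seed ?X n y" for u
    proof -
      have "outward_walk p u n = y n" using that by (simp add: path_event_def)
      then have "outward_walk p u (Suc n) = (if u n < t then y n + e else y n - e)"
        using n by (simp add: Let_def t_def e_def)
      then show ?thesis by (auto simp: B_def d_def e_def)
    qed
    ultimately show "\<exists>B\<in>sets unif01. measure unif01 B = erw_transition p n (y n) (y (Suc n) - y n) \<and>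
        (\<forall>u\<in>path_event uniform_seed ?X n y. ?X (Suc n) u = y (Suc n) \<longleftrightarrow> u n \<in> B)"
      unfolding d_def[symmetric] by (intro bexI[of _ B]) (auto simp: B_def)
  qed (use measurable_outward_walk prob_space_unif01 in auto)
qed simp_all

lemma elephant_random_walk_outward_walk:
  assumes "0 \<le> p" "p \<le> 1"
  shows "elephant_random_walk uniform_seed p (\<lambda>n u. outward_walk p u n)"
proof -
  have "(\<lambda>\<omega>. erw_walk \<omega> n) \<in> measurable (erw_seed p) (count_space UNIV)" for n
    using measurable_compose[OF measurable_erw_walk measurable_component_singleton, of n] by simp
  then have "distr uniform_seed int_paths (\<lambda>u n. outward_walk p u n) = erw_law p"
    unfolding erw_law_def
    using erw_markov_path_law_unique[OF prob_space_uniform_seed prob_space_erw_seed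
        erw_markov_outward_walk[OF assms] erw_markov_erw_walk[OF assms] measurable_outward_walk]
    by simp
  then show ?thesis
    by (simp add: elephant_random_walk_def prob_space_uniform_seed measurable_outward_walk)
qed

theorem proposition1p9:
  fixes p1 p2 :: real
  assumes "0 \<le> p1" and "p1 \<le> p2" and "p2 \<le> 1"
  shows "\<exists>(M :: (nat \<Rightarrow> real) measure) (S :: nat \<Rightarrow> (nat \<Rightarrow> real) \<Rightarrow> int) (S' :: nat \<Rightarrow> (nat \<Rightarrow> real) \<Rightarrow> int).
    prob_space M \<and>
    nearest_neighbor_walk M S \<and> nearest_neighbor_walk M S' \<and>
    elephant_random_walk M p1 S \<and> elephant_random_walk M p2 S' \<and>
    (\<forall>\<omega>\<in>space M. \<forall>n\<ge>1. \<bar>S n \<omega>\<bar> \<le> \<bar>S' n \<omega>\<bar>) \<and>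
    (\<forall>\<omega>\<in>space M. \<forall>n\<ge>1. S' n \<omega> = 0 \<longrightarrow> S n \<omega> = 0)"
proof (intro exI conjI ballI allI impI)
  show "prob_space uniform_seed" by (rule prob_space_uniform_seed)
  show "nearest_neighbor_walk uniform_seed (\<lambda>n u. outward_walk p1 u n)"
    "nearest_neighbor_walk uniform_seed (\<lambda>n u. outward_walk p2 u n)"
    unfolding nearest_neighbor_walk_def
    by (auto simp only: measurable_outward_walk abs_outward_walk_step)
  show "elephant_random_walk uniform_seed p1 (\<lambda>n u. outward_walk p1 u n)"
    "elephant_random_walk uniform_seed p2 (\<lambda>n u. outward_walk p2 u n)"
    using assms by (auto intro: elephant_random_walk_outward_walk)
  fix u n
  show le: "\<bar>outward_walk p1 u n\<bar> \<le> \<bar>outward_walk p2 u n\<bar>"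
    by (rule abs_outward_walk_mono) (rule assms)
  show "outward_walk p2 u n = 0 \<Longrightarrow> outward_walk p1 u n = 0"
    using le by simp
qed

end
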